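(* Let $\mathcal{A}=(a_{i_1i_2\cdots i_m})$ be a real symmetric $H$-tensor of even order $m$ and dimension $n$ all of whose diagonal entries $a_{ii\cdots i}$ are nonnegative. Then $\mathcal{A}$ has an SOS tensor decomposition.
   Context: A real tensor of order $m$ and dimension $n$ is an array $\mathcal{A}=(a_{i_1\cdots i_m})$ with $i_1,\dots,i_m\in[n]=\{1,\dots,n\}$; it is symmetric if its entries are invariant under permutations of the indices. Its associated form is $f_{\mathcal{A}}(\mathbf{x})=\mathcal{A}\mathbf{x}^m=\sum_{i_1,\dots,i_m\in[n]}a_{i_1\cdots i_m}x_{i_1}\cdots x_{i_m}$. For even $m$, $\mathcal{A}$ has an SOS tensor decomposition if $f_{\mathcal{A}}$ is a finite sum of squares of real polynomials. The comparison tensor $\mathcal{M}(\mathcal{A})=(m_{i_1\cdots i_m})$ has $m_{ii\cdots i}=|a_{ii\cdots i}|$ and $m_{i_1\cdots i_m}=-|a_{i_1\cdots i_m}|$ when $i_1,\dots,i_m$ are not all equal. $\mathcal{A}$ is an $H$-tensor if there exist an entrywise nonnegative tensor $\mathcal{Z}$ and a real $s\ge\rho(\mathcal{Z})$ with $\mathcal{M}(\mathcal{A})=s\mathcal{I}-\mathcal{Z}$. Here $\mathcal{I}$ is the identity tensor (entries $1$ if all indices are equal, $0$ otherwise), and $\rho(\mathcal{Z})$ is the maximum modulus of all eigenvalues of $\mathcal{Z}=(z_{i_1\cdots i_m})$, where $\lambda\in\mathbb{C}$ is an eigenvalue if there is $\mathbf{x}\in\mathbb{C}^n\setminus\{0\}$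 with $\sum_{i_2,\dots,i_m=1}^n z_{ii_2\cdots i_m}x_{i_2}\cdots x_{i_m}=\lambda x_i^{m-1}$ for all $i\in[n]$. *)

theory Defs
  imports
    "HOL-Analysis.Analysis"
    "HOL-Library.Poly_Mapping"
    "HOL-Library.Multiset"
begin

section \<open>Tensors\<close>

text \<open>
  A tensor of order \<open>m\<close> and dimension \<open>CARD('n)\<close> is represented by a function on index lists
  \<open>[i\<^sub>1, \<dots>, i\<^sub>m]\<close>. Only the values on lists of length \<open>m\<close> are entries; every notion below takes
  the order \<open>m\<close> as an argument, and the values on lists of other lengths are irrelevant.
\<close>

type_synonym 'n tensor = "'n list \<Rightarrow> real"

definition symmetric_tensor :: "nat \<Rightarrow> 'n tensor \<Rightarrow> bool" where
  "symmetric_tensor m A \<longleftrightarrow> (\<forall>is js. length is = m \<longrightarrow> mset is = mset js \<longrightarrow> A is = A js)"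

definition nonneg_tensor :: "nat \<Rightarrow> 'n tensor \<Rightarrow> bool" where
  "nonneg_tensor m A \<longleftrightarrow> (\<forall>is. length is = m \<longrightarrow> 0 \<le> A is)"

definition diagonal_index :: "'n list \<Rightarrow> bool" where
  "diagonal_index is \<longleftrightarrow> (\<exists>i. is = replicate (length is) i)"

definition identity_tensor :: "'n tensor" where
  "identity_tensor is = (if diagonal_index is then 1 else 0)"

definition comparison_tensor :: "'n tensor \<Rightarrow> 'n tensor" where
  "comparison_tensor A is = (if diagonal_index is then \<bar>A is\<bar> else - \<bar>A is\<bar>)"


section \<open>Eigenvalues and H-tensors\<close>

definition tensor_eigenpair :: "nat \<Rightarrow> ('n::finite) tensor \<Rightarrow> complex \<Rightarrow> complex ^ 'n \<Rightarrow> bool" where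
  "tensor_eigenpair m Z l x \<longleftrightarrow> x \<noteq> 0 \<and>
     (\<forall>i. (\<Sum>is | length is = m - 1. of_real (Z (i # is)) * (\<Prod>j\<leftarrow>is. x $ j)) = l * (x $ i) ^ (m - 1))"

definition tensor_eigenvalue :: "nat \<Rightarrow> ('n::finite) tensor \<Rightarrow> complex \<Rightarrow> bool" where
  "tensor_eigenvalue m Z l \<longleftrightarrow> (\<exists>x. tensor_eigenpair m Z l x)"

text \<open>
  The supremum below is a maximum whenever there is an eigenvalue at all:
  see \<open>tensor_spectral_radius_attained\<close>.
\<close>

definition tensor_spectral_radius :: "nat \<Rightarrow> ('n::finite) tensor \<Rightarrow> real" where
  "tensor_spectral_radius m Z = Sup (cmod ` {l. tensor_eigenvalue m Z l})"

definition H_tensor :: "nat \<Rightarrow> ('n::finite) tensor \<Rightarrow> bool" where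
  "H_tensor m A \<longleftrightarrow> (\<exists>Z s. nonneg_tensor m Z \<and> s \<ge> tensor_spectral_radius m Z \<and>
     (\<forall>is. length is = m \<longrightarrow> comparison_tensor A is = s * identity_tensor is - Z is))"

lemma finite_index_lists: "finite {is :: 'n::finite list. length is = k}"
  using finite_lists_length_eq[of "UNIV :: 'n set" k] by simp

lemma prod_list_scale:
  fixes x :: "complex ^ 'n"
  shows "(\<Prod>j\<leftarrow>is. (c *s x) $ j) = c ^ length is * (\<Prod>j\<leftarrow>is. x $ j)"
  by (induction "is") (auto simp: algebra_simps)

lemma tensor_eigenpair_scale:
  fixes x :: "complex ^ 'n::finite"
  assumes "tensor_eigenpair m Z l x" "c \<noteq> 0"
  shows "tensor_eigenpair m Z l (c *s x)"
proof -
  have "(\<Sum>is | length is = m - 1. of_real (Z (i # is)) * (\<Prod>j\<leftarrow>is. (c *s x) $ j))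
      = l * ((c *s x) $ i) ^ (m - 1)" for i
  proof -
    have "(\<Sum>is | length is = m - 1. of_real (Z (i # is)) * (\<Prod>j\<leftarrow>is. (c *s x) $ j))
        = c ^ (m - 1) * (\<Sum>is | length is = m - 1. of_real (Z (i # is)) * (\<Prod>j\<leftarrow>is. x $ j))"
      unfolding prod_list_scale sum_distrib_left
      by (intro sum.cong) auto
    also have "\<dots> = c ^ (m - 1) * (l * (x $ i) ^ (m - 1))"
      using assms(1) by (simp add: tensor_eigenpair_def)
    finally show ?thesis by (simp add: power_mult_distrib)
  qed
  moreover have "c *s x \<noteq> 0"
    using assms by (simp add: tensor_eigenpair_def)
  ultimately show ?thesis
    by (simp only: tensor_eigenpair_def) blast
qed

lemma tensor_eigenvalue_normalized:
  fixes Z :: "('n::finite) tensor"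
  assumes "tensor_eigenvalue m Z l"
  obtains x i where "tensor_eigenpair m Z l x" "cmod (x $ i) = 1" "\<And>j. cmod (x $ j) \<le> 1"
proof -
  from assms obtain x where x: "tensor_eigenpair m Z l x"
    by (auto simp: tensor_eigenvalue_def)
  obtain i where i: "\<And>j. cmod (x $ j) \<le> cmod (x $ i)"
  proof -
    have "Max (range (\<lambda>j. cmod (x $ j))) \<in> range (\<lambda>j. cmod (x $ j))"
      by (intro Max_in) auto
    then obtain i where "Max (range (\<lambda>j. cmod (x $ j))) = cmod (x $ i)" by (elim imageE)
    then have "\<And>j. cmod (x $ j) \<le> cmod (x $ i)"
      by (metis Max_ge finite finite_imageI rangeI)
    then show ?thesis using that by blast
  qed
  obtain k where "x $ k \<noteq> 0"
    using x by (auto simp: tensor_eigenpair_def vec_eq_iff)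
  then have nz: "x $ i \<noteq> 0"
    using i[of k] by auto
  define c where "c = 1 / x $ i"
  have "tensor_eigenpair m Z l (c *s x)"
    using x nz by (intro tensor_eigenpair_scale) (auto simp: c_def)
  moreover have "cmod ((c *s x) $ i) = 1"
    using nz by (simp add: c_def)
  moreover have "cmod ((c *s x) $ j) \<le> 1" for j
    using i[of j] nz by (simp add: c_def norm_divide divide_simps)
  ultimately show ?thesis using that by blast
qed

lemma norm_prod_list_le_one:
  assumes "\<And>j. cmod (x $ j) \<le> 1"
  shows "cmod (\<Prod>j\<leftarrow>is. x $ j) \<le> 1"
  using assms by (induction "is") (auto simp: norm_mult mult_le_one)

lemma continuous_on_prod_list_nth [continuous_intros]:
  fixes f :: "'a::topological_space \<Rightarrow> complex ^ 'n"
  assumes "continuous_on S f"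
  shows "continuous_on S (\<lambda>x. \<Prod>j\<leftarrow>is. f x $ j)"
  using assms by (induction "is") (auto intro!: continuous_intros)

lemma tensor_spectral_radius_attained:
  fixes Z :: "('n::finite) tensor"
  assumes "tensor_eigenvalue m Z l"
  shows "\<exists>l. tensor_eigenvalue m Z l \<and> cmod l = tensor_spectral_radius m Z"
    and "cmod l \<le> tensor_spectral_radius m Z"
proof -
  define B where "B = (\<Sum>i\<in>UNIV. \<Sum>is | length is = m - 1. \<bar>Z (i # is)\<bar>)"
  define F where "F i x = (\<Sum>is | length is = m - 1. of_real (Z (i # is)) * (\<Prod>j\<leftarrow>is. x $ j))"
    for i :: 'n and x :: "complex ^ 'n"
  define K where "K = {p :: complex \<times> (complex ^ 'n). cmod (fst p) \<le> B \<and>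
     (\<forall>j. cmod (snd p $ j) \<le> 1) \<and> (\<exists>j. cmod (snd p $ j) = 1) \<and>
     (\<forall>i. F i (snd p) = fst p * (snd p $ i) ^ (m - 1))}"
  have eigen: "tensor_eigenvalue m Z l" if "(l, x) \<in> K" for l x
  proof -
    have "x \<noteq> 0" using that by (auto simp: K_def)
    then show ?thesis
      using that unfolding tensor_eigenvalue_def tensor_eigenpair_def K_def F_def by auto
  qed
  have exK: "\<exists>x. (l, x) \<in> K" if ev: "tensor_eigenvalue m Z l" for l
  proof -
    obtain x i where x: "tensor_eigenpair m Z l x" "cmod (x $ i) = 1" "\<And>j. cmod (x $ j) \<le> 1"
      using tensor_eigenvalue_normalized[OF ev] by blast
    have eq: "F i x = l * (x $ i) ^ (m - 1)" for i
      using x(1) by (simp add: tensor_eigenpair_def F_def)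
    have "cmod l = cmod (F i x)"
      using x(2) by (simp add: eq norm_mult norm_power)
    also have "\<dots> \<le> (\<Sum>is | length is = m - 1. \<bar>Z (i # is)\<bar>)"
      unfolding F_def
    proof (rule sum_norm_le)
      fix "is"
      show "cmod (of_real (Z (i # is)) * (\<Prod>j\<leftarrow>is. x $ j)) \<le> \<bar>Z (i # is)\<bar>"
        using norm_prod_list_le_one[OF x(3), of "is"]
        by (simp add: norm_mult mult_left_le)
    qed
    also have "\<dots> \<le> B"
      unfolding B_def by (rule member_le_sum) (auto intro: sum_nonneg)
    finally have "(l, x) \<in> K"
      using x eq unfolding K_def by auto
    then show ?thesis ..
  qed
  have contF: "continuous_on UNIV (\<lambda>p. F i (snd p))" for i
    unfolding F_def by (intro continuous_intros)
  have "closed K"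
  proof -
    have "closed (\<Union>j. {p :: complex \<times> (complex ^ 'n). cmod (snd p $ j) = 1})"
      by (intro closed_UN closed_Collect_eq ballI continuous_intros) auto
    then have "closed {p :: complex \<times> (complex ^ 'n). \<exists>j. cmod (snd p $ j) = 1}"
      by (simp add: Collect_ex_eq)
    then show ?thesis
      unfolding K_def
      by (intro closed_Collect_conj closed_Collect_all closed_Collect_le
          closed_Collect_eq contF continuous_intros)
  qed
  moreover have "bounded K"
  proof -
    have "K \<subseteq> cball 0 B \<times> cball 0 (real CARD('n))"
    proof
      fix p assume "p \<in> K"
      then have "cmod (fst p) \<le> B" and *: "\<And>j. cmod (snd p $ j) \<le> 1" by (auto simp: K_def)
      moreover have "norm (snd p) \<le> (\<Sum>j\<in>(UNIV :: 'n set). cmod (snd p $ j))"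
        unfolding norm_vec_def by (intro L2_set_le_sum) auto
      moreover have "\<dots> \<le> real CARD('n)"
        using sum_mono[of UNIV "\<lambda>j. cmod (snd p $ j)" "\<lambda>_. 1"] * by simp
      ultimately show "p \<in> cball 0 B \<times> cball 0 (real CARD('n))"
        by (cases p) auto
    qed
    then show ?thesis
      by (rule bounded_subset[rotated]) (intro bounded_Times bounded_cball)
  qed
  ultimately have "compact K" by (simp add: compact_eq_bounded_closed)
  moreover have "K \<noteq> {}" using exK[OF assms] by auto
  moreover have "continuous_on K (\<lambda>p. cmod (fst p))" by (intro continuous_intros)
  ultimately obtain p where p: "p \<in> K" "\<And>q. q \<in> K \<Longrightarrow> cmod (fst q) \<le> cmod (fst p)"
    using continuous_attains_sup[of K "\<lambda>p. cmod (fst p)"] by blast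
  have ev: "tensor_eigenvalue m Z (fst p)"
    using p(1) by (intro eigen[of _ "snd p"]) simp
  have max: "cmod l \<le> cmod (fst p)" if "tensor_eigenvalue m Z l" for l
    using exK[OF that] p(2) by fastforce
  have "tensor_spectral_radius m Z = cmod (fst p)"
    unfolding tensor_spectral_radius_def
    by (rule cSup_eq_maximum) (use ev max in auto)
  then show "\<exists>l. tensor_eigenvalue m Z l \<and> cmod l = tensor_spectral_radius m Z"
    and "cmod l \<le> tensor_spectral_radius m Z"
    using ev max assms by auto
qed


section \<open>Associated form and SOS decomposition\<close>

text \<open>
  Real polynomials in the variables \<open>x\<^sub>i\<close>, \<open>i :: 'n\<close>, are finitely supported maps from exponent
  vectors to coefficients; multiplication on this type is the convolution product.
\<close>

type_synonym 'n real_mpoly = "('n \<Rightarrow>\<^sub>0 nat) \<Rightarrow>\<^sub>0 real"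

definition mpoly_const :: "real \<Rightarrow> 'n real_mpoly" where
  "mpoly_const c = Poly_Mapping.single 0 c"

definition mpoly_var :: "'n \<Rightarrow> 'n real_mpoly" where
  "mpoly_var i = Poly_Mapping.single (Poly_Mapping.single i 1) 1"

definition tensor_form :: "nat \<Rightarrow> ('n::finite) tensor \<Rightarrow> 'n real_mpoly" where
  "tensor_form m A = (\<Sum>is | length is = m. mpoly_const (A is) * (\<Prod>i\<leftarrow>is. mpoly_var i))"

definition has_SOS_decomposition :: "nat \<Rightarrow> ('n::finite) tensor \<Rightarrow> bool" where
  "has_SOS_decomposition m A \<longleftrightarrow>
     (\<exists>(k::nat) (q :: nat \<Rightarrow> 'n real_mpoly). tensor_form m A = (\<Sum>r<k. (q r)\<^sup>2))"

end

theory Submission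
  imports Defs
begin

text \<open>
  Write the comparison tensor as \<open>sI - Z\<close>. Maximizing the form of the symmetric tensor \<open>Z\<close> over
  nonnegative vectors with \<open>\<Sum> x\<^sub>i\<^sup>m = 1\<close> yields an eigenvalue, so the maximum is at most \<open>s\<close>. The
  support of a maximizer decouples from its complement, and maximizing again on the complement
  produces a positive vector \<open>y\<close> with \<open>Z y\<^sup>m\<^sup>-\<^sup>1 \<le> s y\<^sup>[\<^sup>m\<^sup>-\<^sup>1\<^sup>]\<close>. Substituting \<open>x\<^sub>i = y\<^sub>i u\<^sub>i\<close>
  makes the tensor diagonally dominant; its form is then a nonnegative combination of the \<open>u\<^sub>i\<^sup>m\<close>
  and of the differences \<open>\<Sum>\<^sub>k u\<^sub>i\<^sub>k\<^sup>m / m \<plusminus> u\<^sub>i\<^sub>1 \<cdots> u\<^sub>i\<^sub>m\<close>, which are sums of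
  squares by Hurwitz's form of the arithmetic-geometric mean inequality.
\<close>

section \<open>Sums over index lists\<close>

lemma sum_lists_Suc:
  fixes f :: "'n::finite list \<Rightarrow> 'b::comm_monoid_add"
  shows "(\<Sum>is | length is = Suc n. f is) = (\<Sum>j\<in>UNIV. \<Sum>is | length is = n. f (j # is))"
proof -
  have eq: "{is :: 'n list. length is = Suc n} = (\<lambda>(j, is). j # is) ` (UNIV \<times> {is. length is = n})"
    by (auto simp: image_iff length_Suc_conv)
  show ?thesis
    unfolding eq by (subst sum.reindex) (auto simp: inj_on_def sum.cartesian_product case_prod_beta)
qed

text \<open>Marking one of the \<open>Suc n\<close> positions of a list: by symmetry it may be moved to the front.\<close>

lemma sum_lists_marked:
  fixes W :: "'n::finite list \<Rightarrow> 'b::comm_semiring_1"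
  assumes "\<And>is js. length is = Suc n \<Longrightarrow> mset is = mset js \<Longrightarrow> W is = W js"
  shows "(\<Sum>is | length is = Suc n. W is * (\<Sum>j\<leftarrow>is. g j))
       = of_nat (Suc n) * (\<Sum>j\<in>UNIV. g j * (\<Sum>is | length is = n. W (j # is)))"
  using assms
proof (induction n arbitrary: W)
  case 0
  show ?case by (simp add: sum_lists_Suc mult.commute)
next
  case (Suc n)
  have IH: "(\<Sum>is | length is = Suc n. W (i # is) * (\<Sum>j\<leftarrow>is. g j))
      = of_nat (Suc n) * (\<Sum>j\<in>UNIV. g j * (\<Sum>is | length is = n. W (i # j # is)))" for i
    by (rule Suc.IH) (rule Suc.prems, auto)
  have swap: "(\<Sum>is | length is = n. W (i # j # is)) = (\<Sum>is | length is = n. W (j # i # is))" for i j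
    by (intro sum.cong refl Suc.prems) auto
  \<comment> \<open>The mark sits on the head or in the tail; a mark in the tail is brought to
    second place by \<open>IH\<close> and then to the front by exchanging the two leading
    indices.\<close>
  have "(\<Sum>is | length is = Suc (Suc n). W is * (\<Sum>j\<leftarrow>is. g j))
      = (\<Sum>i\<in>UNIV. g i * (\<Sum>is | length is = Suc n. W (i # is)))
        + (\<Sum>i\<in>UNIV. \<Sum>is | length is = Suc n. W (i # is) * (\<Sum>j\<leftarrow>is. g j))"
    by (subst sum_lists_Suc) (simp add: distrib_left sum.distrib sum_distrib_left mult.commute)
  also have "(\<Sum>i\<in>UNIV. \<Sum>is | length is = Suc n. W (i # is) * (\<Sum>j\<leftarrow>is. g j))
      = of_nat (Suc n) * (\<Sum>i\<in>UNIV. \<Sum>j\<in>UNIV. g j * (\<Sum>is | length is = n. W (i # j # is)))"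
    unfolding IH by (simp only: sum_distrib_left)
  also have "(\<Sum>i\<in>UNIV. \<Sum>j\<in>UNIV. g j * (\<Sum>is | length is = n. W (i # j # is)))
      = (\<Sum>j\<in>UNIV. \<Sum>i\<in>UNIV. g j * (\<Sum>is | length is = n. W (j # i # is)))"
    by (subst sum.swap) (simp only: swap)
  also have "\<dots> = (\<Sum>j\<in>UNIV. g j * (\<Sum>is | length is = Suc n. W (j # is)))"
    by (simp only: sum_lists_Suc sum_distrib_left)
  finally show ?case by (simp add: algebra_simps)
qed

section \<open>Products over index lists\<close>

lemma prod_list_map_mset_cong:
  fixes f :: "'a \<Rightarrow> 'b::comm_monoid_mult"
  assumes "mset xs = mset ys"
  shows "prod_list (map f xs) = prod_list (map f ys)"
  using assms by (metis mset_map prod_mset_prod_list)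

lemma prod_list_map_scale:
  fixes f :: "'a \<Rightarrow> 'b::comm_monoid_mult"
  shows "(\<Prod>j\<leftarrow>xs. c * f j) = c ^ length xs * (\<Prod>j\<leftarrow>xs. f j)"
  by (induction xs) (auto simp: algebra_simps)

lemma prod_list_map_nonneg:
  fixes f :: "'a \<Rightarrow> real"
  assumes "\<And>j. j \<in> set xs \<Longrightarrow> 0 \<le> f j"
  shows "0 \<le> (\<Prod>j\<leftarrow>xs. f j)"
  using assms by (induction xs) auto

lemma power_le_prod_list_map:
  fixes f :: "'a \<Rightarrow> real"
  assumes "0 \<le> c" "\<And>j. j \<in> set xs \<Longrightarrow> c \<le> f j"
  shows "c ^ length xs \<le> (\<Prod>j\<leftarrow>xs. f j)"
  using assms(2)
proof (induction xs)
  case (Cons a xs)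
  then have "c * c ^ length xs \<le> f a * (\<Prod>j\<leftarrow>xs. f j)"
    using assms(1) order_trans[OF assms(1)] by (intro mult_mono) auto
  then show ?case by simp
qed simp

section \<open>Maximizing a nonnegative symmetric form\<close>

definition form_value :: "nat \<Rightarrow> ('n::finite) tensor \<Rightarrow> ('n \<Rightarrow> real) \<Rightarrow> real" where
  "form_value m Z z = (\<Sum>is | length is = m. Z is * (\<Prod>j\<leftarrow>is. z j))"

lemma form_value_scale: "form_value m Z (\<lambda>i. c * z i) = c ^ m * form_value m Z z"
  unfolding form_value_def prod_list_map_scale sum_distrib_left by (intro sum.cong) auto

text \<open>The nonnegative vectors supported on \<open>T\<close> whose \<open>m\<close>-th powers
  sum to 1 form a nonempty compact set, so a maximum exists, and homogeneity carries the bound to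
  every scale. Prescribing \<open>T\<close> allows a further maximization on the complement of a
  support.\<close>

lemma form_value_maximizer:
  fixes Z :: "('n::finite) tensor" and T :: "'n set"
  assumes "0 < m" "T \<noteq> {}"
  obtains l y where "\<And>i. 0 \<le> y i" "\<And>i. i \<notin> T \<Longrightarrow> y i = 0" "(\<Sum>i\<in>UNIV. y i ^ m) = 1"
    "form_value m Z y = l"
    "\<And>z. (\<And>i. 0 \<le> z i) \<Longrightarrow> (\<And>i. i \<notin> T \<Longrightarrow> z i = 0) \<Longrightarrow>
       form_value m Z z \<le> l * (\<Sum>i\<in>UNIV. z i ^ m)"
proof -
  define K where "K = {x :: real ^ 'n. (\<forall>i. 0 \<le> x $ i) \<and> (\<forall>i\<in>-T. x $ i = 0) \<and> (\<Sum>i\<in>UNIV. x $ i ^ m) = 1}"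
  have cont: "continuous_on K (\<lambda>x. form_value m Z (\<lambda>i. x $ i))"
  proof -
    have "continuous_on K (\<lambda>x. \<Prod>j\<leftarrow>is. x $ j)" for "is" :: "'n list"
      by (induction "is") (auto intro!: continuous_intros)
    then show ?thesis unfolding form_value_def by (intro continuous_intros)
  qed
  have "closed K"
    unfolding K_def Ball_def
    by (intro closed_Collect_conj closed_Collect_all closed_Collect_imp closed_Collect_le
        closed_Collect_eq continuous_intros) auto
  moreover have "bounded K"
  proof (rule boundedI)
    fix x assume x: "x \<in> K"
    have "\<bar>x $ i\<bar> \<le> 1" for i
    proof (rule ccontr)
      assume "\<not> ?thesis"
      then have gt: "1 < x $ i" using x by (auto simp: K_def)
      have "x $ i ^ m \<le> (\<Sum>i\<in>UNIV. x $ i ^ m)"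
        by (rule member_le_sum) (use x in \<open>auto simp: K_def\<close>)
      moreover have "1 < x $ i ^ m" using gt assms by (simp add: one_less_power)
      ultimately show False using x by (simp add: K_def)
    qed
    then have "(\<Sum>i\<in>UNIV. \<bar>x $ i\<bar>) \<le> (\<Sum>i\<in>(UNIV :: 'n set). 1)" by (intro sum_mono) auto
    then show "norm x \<le> real CARD('n)" using norm_le_l1_cart[of x] by simp
  qed
  ultimately have "compact K" by (simp add: compact_eq_bounded_closed)
  moreover obtain i where "i \<in> T" using assms by auto
  then have "(\<chi> j. if j = i then 1 else 0) \<in> K"
    using assms(1) by (auto simp: K_def if_distrib[of "\<lambda>x. x ^ m"] zero_power cong: if_cong)
  ultimately obtain x where x: "x \<in> K"
    and max: "\<And>w. w \<in> K \<Longrightarrow> form_value m Z (\<lambda>i. w $ i) \<le> form_value m Z (\<lambda>i. x $ i)"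
    using continuous_attains_sup[OF _ _ cont] by blast
  define l where "l = form_value m Z (\<lambda>i. x $ i)"
  have "form_value m Z z \<le> l * (\<Sum>i\<in>UNIV. z i ^ m)"
    if z: "\<And>i. 0 \<le> z i" "\<And>i. i \<notin> T \<Longrightarrow> z i = 0" for z
  proof (cases "\<forall>i. z i = 0")
    case True
    \<comment> \<open>The zero vector is 0 times itself, so homogeneity with positive
      \<open>m\<close> gives the value 0.\<close>
    then have "z = (\<lambda>i. 0 * z i)" by (simp add: fun_eq_iff)
    then have "form_value m Z z = form_value m Z (\<lambda>i. 0 * z i)" by (rule arg_cong)
    also have "\<dots> = 0 ^ m * form_value m Z z" by (rule form_value_scale)
    also have "\<dots> = 0" using assms(1) by (simp add: zero_power)
    finally have "form_value m Z z = 0" .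
    then show ?thesis using True assms by (simp add: zero_power)
  next
    case False
    then obtain k where k: "z k \<noteq> 0" by auto
    have "0 < z k ^ m" using z(1)[of k] k by simp
    also have "\<dots> \<le> (\<Sum>i\<in>UNIV. z i ^ m)" by (rule member_le_sum) (auto simp: z)
    finally have pos: "0 < (\<Sum>i\<in>UNIV. z i ^ m)" .
    define r where "r = root m (\<Sum>i\<in>UNIV. z i ^ m)"
    have r: "0 < r" "r ^ m = (\<Sum>i\<in>UNIV. z i ^ m)" using pos assms by (auto simp: r_def)
    have "(\<chi> i. inverse r * z i) \<in> K"
      using z r pos by (auto simp: K_def power_mult_distrib power_inverse simp flip: sum_distrib_left)
    from max[OF this] have "form_value m Z (\<lambda>i. inverse r * z i) \<le> l" by (simp add: l_def)
    then have "inverse r ^ m * form_value m Z z \<le> l" by (simp only: form_value_scale)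
    then have "form_value m Z z \<le> l * r ^ m" using r(1) by (simp add: field_simps)
    then show ?thesis by (simp add: r)
  qed
  with x show ?thesis
    by (intro that[of "\<lambda>i. x $ i" l]) (auto simp: K_def l_def)
qed

text \<open>Stationarity in one coordinate: multiplying coordinate \<open>i\<close> by
  \<open>u\<close> near 1 keeps the vector admissible, so the difference of the two sides of
  \<open>max\<close> has a local maximum at \<open>u = 1\<close>. By symmetry of \<open>Z\<close>
  its derivative there is \<open>m * y i\<close> times the difference of the two sides of the
  eigenvalue equation.\<close>

lemma maximizer_eigen:
  fixes Z :: "('n::finite) tensor"
  assumes "0 < m" "symmetric_tensor m Z"
    and y: "\<And>i. 0 \<le> y i" "\<And>i. i \<notin> T \<Longrightarrow> y i = 0" "form_value m Z y = l * (\<Sum>i\<in>UNIV. y i ^ m)"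
    and max: "\<And>z. (\<And>i. 0 \<le> z i) \<Longrightarrow> (\<And>i. i \<notin> T \<Longrightarrow> z i = 0) \<Longrightarrow>
       form_value m Z z \<le> l * (\<Sum>i\<in>UNIV. z i ^ m)"
    and i: "0 < y i"
  shows "(\<Sum>is | length is = m - 1. Z (i # is) * (\<Prod>j\<leftarrow>is. y j)) = l * y i ^ (m - 1)"
proof -
  obtain n where n: "m = Suc n" using assms by (cases m) auto
  define W where "W is = Z is * (\<Prod>j\<leftarrow>is. y j)" for "is"
  \<comment> \<open>\<open>c is\<close> counts the occurrences of \<open>i\<close>; it is the
    exponent of \<open>u\<close> in the monomial of \<open>is\<close>.\<close>
  define c where "c is = (\<Sum>j\<leftarrow>is. if j = i then 1 else 0 :: nat)" for "is" :: "'n list"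
  define z where "z u j = (if j = i then u * y j else y j)" for u j
  have prod_z: "(\<Prod>j\<leftarrow>is. z u j) = u ^ c is * (\<Prod>j\<leftarrow>is. y j)" for u "is"
    unfolding c_def z_def by (induction "is") (auto simp: algebra_simps)
  have sum_z: "(\<Sum>j\<in>UNIV. z u j ^ m) = u ^ m * y i ^ m + (\<Sum>j\<in>UNIV - {i}. y j ^ m)" for u
    by (subst sum.remove[of _ i]) (auto simp: z_def power_mult_distrib)
  define F where "F u = (\<Sum>is | length is = m. W is * u ^ c is)
      - l * (u ^ m * y i ^ m + (\<Sum>j\<in>UNIV - {i}. y j ^ m))" for u
  have F: "F u = form_value m Z (z u) - l * (\<Sum>j\<in>UNIV. z u j ^ m)" for u
    unfolding F_def form_value_def prod_z sum_z W_def by (simp add: algebra_simps)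
  have F_le: "F u \<le> 0" if "0 \<le> u" for u
  proof -
    have "form_value m Z (z u) \<le> l * (\<Sum>j\<in>UNIV. z u j ^ m)"
      using y that by (intro max) (auto simp: z_def)
    then show ?thesis by (simp add: F)
  qed
  have F1: "F 1 = 0"
  proof -
    have "z 1 = y" by (auto simp: z_def)
    then show ?thesis using y by (simp add: F)
  qed
  have "(F has_real_derivative ((\<Sum>is | length is = m. W is * real (c is)) - l * (real m * y i ^ m))) (at 1)"
    unfolding F_def by (auto intro!: derivative_eq_intros sum.cong)
  then have "(\<Sum>is | length is = m. W is * real (c is)) - l * (real m * y i ^ m) = 0"
  proof (rule DERIV_local_max[where d = 1])
    \<comment> \<open>Radius 1 keeps \<open>u\<close> positive, hence \<open>z u\<close>
      nonnegative.\<close>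
    show "\<forall>u. \<bar>1 - u\<bar> < 1 \<longrightarrow> F u \<le> F 1"
      unfolding F1 by (intro allI impI F_le) linarith
  qed simp
  moreover have c: "real (c is) = (\<Sum>j\<leftarrow>is. if j = i then 1 else 0)" for "is"
    unfolding c_def by (induction "is") auto
  have W_sym: "W is = W js" if "length is = Suc n" "mset is = mset js" for "is" js
  proof -
    have "Z is = Z js" using assms(2) that unfolding symmetric_tensor_def n by blast
    then show ?thesis by (simp only: W_def prod_list_map_mset_cong[OF that(2), of y])
  qed
  \<comment> \<open>Each occurrence of \<open>i\<close> is a mark, so the exponents turn into a
    factor \<open>m\<close> and a leading index \<open>i\<close>.\<close>
  have "(\<Sum>is | length is = m. W is * real (c is))
      = real m * (\<Sum>j\<in>UNIV. (if j = i then 1 else 0) * (\<Sum>is | length is = n. W (j # is)))"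
    unfolding n c using W_sym by (rule sum_lists_marked)
  then have "(\<Sum>is | length is = m. W is * real (c is)) = real m * (\<Sum>is | length is = n. W (i # is))"
    by (simp add: if_distrib[of "\<lambda>x. x * c" for c] cong: if_cong)
  ultimately have "real m * (\<Sum>is | length is = n. W (i # is)) = real m * (l * y i ^ m)"
    by (simp add: mult.left_commute)
  then have "(\<Sum>is | length is = n. W (i # is)) = l * y i ^ m"
    using assms(1) by simp
  moreover have "(\<Sum>is | length is = n. W (i # is))
      = y i * (\<Sum>is | length is = n. Z (i # is) * (\<Prod>j\<leftarrow>is. y j))"
    unfolding W_def sum_distrib_left by (intro sum.cong) auto
  ultimately show ?thesis using i by (simp add: n)
qed

text \<open>
  Switching on the coordinates outside the support at a small value \<open>t\<close> costs order \<open>t\<^sup>m\<close>, whereas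
  an entry mixing indices inside and outside the support gains at least order \<open>t\<^sup>m\<^sup>-\<^sup>1\<close>.
\<close>

lemma maximizer_support_decoupled:
  fixes Z :: "('n::finite) tensor"
  assumes "symmetric_tensor m Z" "nonneg_tensor m Z"
    and y: "\<And>i. 0 \<le> y i" "\<And>i. i \<notin> T \<Longrightarrow> y i = 0" "form_value m Z y = l * (\<Sum>i\<in>UNIV. y i ^ m)"
    and max: "\<And>z. (\<And>i. 0 \<le> z i) \<Longrightarrow> (\<And>i. i \<notin> T \<Longrightarrow> z i = 0) \<Longrightarrow>
       form_value m Z z \<le> l * (\<Sum>i\<in>UNIV. z i ^ m)"
    and js: "length js = m" "set js \<subseteq> T" "i \<in> set js" "0 < y i" "k \<in> set js" "y k = 0"
  shows "Z js = 0"
proof (rule ccontr)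
  assume "Z js \<noteq> 0"
  then have Zpos: "0 < Z js" using assms(2) js(1) by (auto simp: nonneg_tensor_def less_le)
  have "0 < m" using js by (cases js) auto
  then obtain n where n: "m = Suc n" by (cases m) auto
  \<comment> \<open>A common lower bound of 1 and of all positive entries, so that
    \<open>d * t\<close> bounds every perturbed coordinate in \<open>T\<close> from below.\<close>
  define d where "d = Min (insert 1 (y ` {i. 0 < y i}))"
  have d: "0 < d" "d \<le> 1" "\<And>i. 0 < y i \<Longrightarrow> d \<le> y i"
    unfolding d_def by (auto intro: Min_le)
  define N where "N = card {j \<in> T. y j = 0}"
  \<comment> \<open>The term of \<open>js\<close> vanishes at \<open>y\<close> because
    \<open>y k = 0\<close>. After the perturbation its product is at least
    \<open>y i * (d * t) ^ n\<close>, as the factor at \<open>i\<close> does not shrink. Dividing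
    gain and cost by \<open>t ^ n\<close> leaves one factor \<open>t\<close> on the right.\<close>
  have bound: "Z js * y i * d ^ n \<le> l * real N * t" if t: "0 < t" "t \<le> 1" for t
  proof -
    define z where "z j = (if j \<in> T \<and> y j = 0 then t else y j)" for j
    have z: "0 \<le> z j" "y j \<le> z j" "j \<notin> T \<Longrightarrow> z j = 0" "j \<in> T \<Longrightarrow> d * t \<le> z j" for j
    proof -
      show "0 \<le> z j" "y j \<le> z j" "j \<notin> T \<Longrightarrow> z j = 0"
        using t y by (auto simp: z_def)
      show "d * t \<le> z j" if "j \<in> T"
      proof (cases "y j = 0")
        case True
        then show ?thesis using that t d by (simp add: z_def mult_left_le_one_le)
      next
        case False
        then have "d \<le> y j" using d y(1)[of j] by (simp add: less_le)
        moreover have "d * t \<le> d" using t d by (simp add: mult_left_le)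
        ultimately show ?thesis using False by (simp add: z_def)
      qed
    qed
    have js_eq: "mset js = mset (i # remove1 i js)" using js(3) by simp
    have "(d * t) ^ n \<le> (\<Prod>j\<leftarrow>remove1 i js. z j)"
    proof -
      have "d * t \<le> z j" if "j \<in> set (remove1 i js)" for j
        using that js(2) z(4) set_remove1_subset[of i js] by blast
      moreover have "length (remove1 i js) = n" using js n by (simp add: length_remove1)
      ultimately show ?thesis
        using power_le_prod_list_map[of "d * t" "remove1 i js" z] d t by simp
    qed
    then have "y i * (d * t) ^ n \<le> z i * (\<Prod>j\<leftarrow>remove1 i js. z j)"
      using z y d t by (intro mult_mono) auto
    also have "\<dots> = (\<Prod>j\<leftarrow>js. z j)"
      using prod_list_map_mset_cong[OF js_eq, of z] by simp
    finally have "Z js * (y i * (d * t) ^ n) \<le> Z js * (\<Prod>j\<leftarrow>js. z j)"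
      using Zpos by simp
    moreover have "form_value m Z y + Z js * (\<Prod>j\<leftarrow>js. z j) \<le> form_value m Z z"
    proof -
      have fin: "finite {is :: 'n list. length is = m}" by (rule finite_index_lists)
      have "(\<Prod>j\<leftarrow>js. y j) = 0" using js by (auto simp: prod_list_zero_iff)
      then have "form_value m Z y = (\<Sum>is\<in>{is. length is = m} - {js}. Z is * (\<Prod>j\<leftarrow>is. y j))"
        unfolding form_value_def using js fin by (subst sum.remove[of _ js]) auto
      also have "\<dots> \<le> (\<Sum>is\<in>{is. length is = m} - {js}. Z is * (\<Prod>j\<leftarrow>is. z j))"
      proof (intro sum_mono mult_left_mono)
        fix "is" assume "is \<in> {is. length is = m} - {js}"
        then show "0 \<le> Z is" using assms(2) by (simp add: nonneg_tensor_def)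
        show "(\<Prod>j\<leftarrow>is. y j) \<le> (\<Prod>j\<leftarrow>is. z j)"
          using y(1) z by (induction "is") (auto intro!: mult_mono prod_list_map_nonneg)
      qed
      finally show ?thesis
        unfolding form_value_def using js fin by (subst (2) sum.remove[of _ js]) auto
    qed
    moreover have "form_value m Z z \<le> l * (\<Sum>i\<in>UNIV. z i ^ m)"
      using z by (intro max) auto
    moreover have "(\<Sum>i\<in>UNIV. z i ^ m) = (\<Sum>i\<in>UNIV. y i ^ m) + real N * t ^ m"
    proof -
      have "z i ^ m = y i ^ m + (if i \<in> {j \<in> T. y j = 0} then t ^ m else 0)" for i
        using \<open>0 < m\<close> by (simp add: z_def)
      then show ?thesis by (simp only: sum.distrib) (simp add: N_def flip: sum.inter_filter)
    qed
    ultimately have "Z js * (y i * (d * t) ^ n) \<le> l * (real N * t ^ m)"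
      using y(3) by (simp add: algebra_simps)
    then have "t ^ n * (Z js * y i * d ^ n) \<le> t ^ n * (l * real N * t)"
      by (simp add: n power_mult_distrib algebra_simps)
    then show ?thesis using t by simp
  qed
  define e where "e = Z js * y i * d ^ n"
  have e: "0 < e" using Zpos js d by (simp add: e_def)
  \<comment> \<open>This choice makes the right side of \<open>bound\<close> at most
    \<open>e / 2\<close>; the added 1 keeps the denominator positive.\<close>
  define t where "t = min 1 (e / (2 * (\<bar>l * real N\<bar> + 1)))"
  have t: "0 < t" "t \<le> 1" "t \<le> e / (2 * (\<bar>l * real N\<bar> + 1))"
    using e by (auto simp: t_def)
  have "e \<le> l * real N * t" using bound[OF t(1,2)] by (simp add: e_def)
  also have "\<dots> \<le> (\<bar>l * real N\<bar> + 1) * t" using t by (intro mult_right_mono) auto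
  also have "\<dots> \<le> e / 2" using t(3) by (simp add: field_simps)
  finally show False using e by simp
qed

text \<open>The maximum over all nonnegative vectors is an eigenvalue of \<open>Z\<close>: on the
  support of the maximizer the equation is stationarity, and off the support both sides vanish by
  decoupling.\<close>

lemma form_value_le_spectral_radius:
  fixes Z :: "('n::finite) tensor"
  assumes "1 < m" "symmetric_tensor m Z" "nonneg_tensor m Z" "\<And>i. 0 \<le> z i"
  shows "form_value m Z z \<le> tensor_spectral_radius m Z * (\<Sum>i\<in>UNIV. z i ^ m)"
proof -
  have "0 < m" using assms by simp
  obtain l y where y: "\<And>i. 0 \<le> y i" "\<And>i. i \<notin> UNIV \<Longrightarrow> y i = 0" "(\<Sum>i\<in>UNIV. y i ^ m) = 1"
    "form_value m Z y = l"
    and max: "\<And>z. (\<And>i. 0 \<le> z i) \<Longrightarrow> (\<And>i. i \<notin> UNIV \<Longrightarrow> z i = 0) \<Longrightarrow>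
       form_value m Z z \<le> l * (\<Sum>i\<in>UNIV. z i ^ m)"
    by (rule form_value_maximizer[OF \<open>0 < m\<close>, of UNIV Z]) auto
  have eq: "form_value m Z y = l * (\<Sum>i\<in>UNIV. y i ^ m)" using y by simp
  have eigen: "(\<Sum>is | length is = m - 1. Z (i # is) * (\<Prod>j\<leftarrow>is. y j)) = l * y i ^ (m - 1)" for i
  proof (cases "y i = 0")
    case False
    then show ?thesis
      using y(1)[of i] by (intro maximizer_eigen[OF \<open>0 < m\<close> assms(2) y(1,2) eq max]) auto
  next
    case True
    \<comment> \<open>Either a factor of the product is zero, or \<open>i\<close> is joined to an
      index of the support and decoupling kills the entry; the tail is nonempty because
      \<open>1 < m\<close>.\<close>
    have "Z (i # is) * (\<Prod>j\<leftarrow>is. y j) = 0" if len: "length is = m - 1" for "is"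
    proof (cases "\<exists>j\<in>set is. y j = 0")
      case True
      then show ?thesis by (auto simp: prod_list_zero_iff)
    next
      case False
      obtain j where j: "j \<in> set is" using len assms(1) by (cases "is") auto
      then have "0 < y j" using False y(1)[of j] by (auto simp: less_le)
      then have "Z (i # is) = 0"
        using len assms(1) j True
        by (intro maximizer_support_decoupled[where i = j and k = i, OF assms(2,3) y(1,2) eq max]) auto
      then show ?thesis by simp
    qed
    then have "(\<Sum>is | length is = m - 1. Z (i # is) * (\<Prod>j\<leftarrow>is. y j)) = 0"
      by (intro sum.neutral) blast
    then show ?thesis using True assms(1) by (simp add: zero_power)
  qed
  have "tensor_eigenvalue m Z (of_real l)"
    unfolding tensor_eigenvalue_def tensor_eigenpair_def
  proof (intro exI conjI allI)
    have "y \<noteq> (\<lambda>_. 0)" using y(3) assms(1) by (auto simp: zero_power)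
    then show "(\<chi> i. complex_of_real (y i)) \<noteq> 0" by (auto simp: vec_eq_iff)
    fix i
    have "(\<Prod>j\<leftarrow>is. (\<chi> i. complex_of_real (y i)) $ j) = of_real (\<Prod>j\<leftarrow>is. y j)" for "is"
      by (induction "is") auto
    then show "(\<Sum>is | length is = m - 1. complex_of_real (Z (i # is)) * (\<Prod>j\<leftarrow>is. (\<chi> i. complex_of_real (y i)) $ j))
        = of_real l * (\<chi> i. complex_of_real (y i)) $ i ^ (m - 1)"
      using arg_cong[OF eigen[of i], of complex_of_real] by simp
  qed
  then have "l \<le> tensor_spectral_radius m Z"
    using tensor_spectral_radius_attained(2) by fastforce
  then have "l * (\<Sum>i\<in>UNIV. z i ^ m) \<le> tensor_spectral_radius m Z * (\<Sum>i\<in>UNIV. z i ^ m)"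
    using assms(4) by (intro mult_right_mono sum_nonneg) auto
  then show ?thesis using max[of z] assms(4) by force
qed

text \<open>
  A maximizer is positive only on its support; since the support decouples from its complement,
  the vector can be completed there by induction.
\<close>

lemma positive_subeigenvector:
  fixes Z :: "('n::finite) tensor" and T :: "'n set"
  assumes "0 < m" "symmetric_tensor m Z" "nonneg_tensor m Z"
    and "\<And>z. (\<And>i. 0 \<le> z i) \<Longrightarrow> (\<And>i. i \<notin> T \<Longrightarrow> z i = 0) \<Longrightarrow>
       form_value m Z z \<le> s * (\<Sum>i\<in>UNIV. z i ^ m)"
  shows "\<exists>y. (\<forall>i\<in>T. 0 < y i) \<and>
     (\<forall>i\<in>T. (\<Sum>is | length is = m - 1 \<and> set is \<subseteq> T. Z (i # is) * (\<Prod>j\<leftarrow>is. y j)) \<le> s * y i ^ (m - 1))"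
  using finite[of T] assms(4)
proof (induction T rule: finite_psubset_induct)
  case (psubset T)
  show ?case
  proof (cases "T = {}")
    case False
    obtain l y where y: "\<And>i. 0 \<le> y i" "\<And>i. i \<notin> T \<Longrightarrow> y i = 0" "(\<Sum>i\<in>UNIV. y i ^ m) = 1"
      "form_value m Z y = l"
      and max: "\<And>z. (\<And>i. 0 \<le> z i) \<Longrightarrow> (\<And>i. i \<notin> T \<Longrightarrow> z i = 0) \<Longrightarrow>
         form_value m Z z \<le> l * (\<Sum>i\<in>UNIV. z i ^ m)"
      by (rule form_value_maximizer[OF \<open>0 < m\<close> False, of Z]) auto
    have eq: "form_value m Z y = l * (\<Sum>i\<in>UNIV. y i ^ m)" using y by simp
    define S where "S = {i. 0 < y i}"
    have S: "i \<in> S \<longleftrightarrow> 0 < y i" "i \<notin> S \<longleftrightarrow> y i = 0" for i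
      using y(1)[of i] by (auto simp: S_def)
    have "S \<subseteq> T" using y(2) by (force simp: S_def)
    have "S \<noteq> {}" using y(3) S(2) assms(1) by (auto simp: zero_power)
    \<comment> \<open>The maximizer is itself admissible in the hypothesis, and its powers sum to
      1.\<close>
    have "l \<le> s" using psubset.prems[of y] y by simp
    have mixed: "Z js = 0" if "length js = m" "set js \<subseteq> T" "i \<in> set js" "i \<in> S" "k \<in> set js" "k \<notin> S" for js i k
      using that S by (intro maximizer_support_decoupled[where i = i and k = k, OF assms(2,3) y(1,2) eq max]) auto
    have "T - S \<subset> T" using \<open>S \<subseteq> T\<close> \<open>S \<noteq> {}\<close> by auto
    then have "\<exists>y. (\<forall>i\<in>T-S. 0 < y i) \<and> (\<forall>i\<in>T-S. (\<Sum>is | length is = m - 1 \<and> set is \<subseteq> T - S.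
       Z (i # is) * (\<Prod>j\<leftarrow>is. y j)) \<le> s * y i ^ (m - 1))"
      by (rule psubset.IH) (auto intro!: psubset.prems)
    then obtain w where w: "\<And>i. i \<in> T - S \<Longrightarrow> 0 < w i"
      "\<And>i. i \<in> T - S \<Longrightarrow> (\<Sum>is | length is = m - 1 \<and> set is \<subseteq> T - S. Z (i # is) * (\<Prod>j\<leftarrow>is. w j)) \<le> s * w i ^ (m - 1)"
      by blast
    \<comment> \<open>The maximizer on \<open>S\<close> is glued to the vector of the induction
      hypothesis on the rest of \<open>T\<close>. Entries joining the two blocks vanish by
      \<open>mixed\<close>, so each row sees only its own block.\<close>
    define v where "v i = (if i \<in> S then y i else w i)" for i
    have fin: "finite {is :: 'n list. length is = m - 1 \<and> P is}" for P
      by (rule finite_subset[OF _ finite_index_lists[of "m - 1"]]) auto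
    show ?thesis
    proof (intro exI[of _ v] conjI ballI)
      fix i assume i: "i \<in> T"
      then show "0 < v i" using w S by (auto simp: v_def)
      show "(\<Sum>is | length is = m - 1 \<and> set is \<subseteq> T. Z (i # is) * (\<Prod>j\<leftarrow>is. v j)) \<le> s * v i ^ (m - 1)"
      proof (cases "i \<in> S")
        case True
        have "(\<Sum>is | length is = m - 1 \<and> set is \<subseteq> T. Z (i # is) * (\<Prod>j\<leftarrow>is. v j))
            = (\<Sum>is | length is = m - 1 \<and> set is \<subseteq> T. Z (i # is) * (\<Prod>j\<leftarrow>is. y j))"
        proof (intro sum.cong refl)
          fix "is" assume "is": "is \<in> {is. length is = m - 1 \<and> set is \<subseteq> T}"
          show "Z (i # is) * (\<Prod>j\<leftarrow>is. v j) = Z (i # is) * (\<Prod>j\<leftarrow>is. y j)"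
          proof (cases "set is \<subseteq> S")
            case True
            then have "map v is = map y is" by (auto simp: v_def)
            then show ?thesis by (simp only:)
          next
            case False
            then obtain k where "k \<in> set is" "k \<notin> S" by auto
            then have "Z (i # is) = 0"
              using \<open>i \<in> S\<close> i "is" assms(1) by (intro mixed[of _ i k]) auto
            then show ?thesis by simp
          qed
        qed
        \<comment> \<open>Lists leaving \<open>T\<close> contribute nothing since \<open>y\<close>
          vanishes there; this restores the full sum of \<open>maximizer_eigen\<close>.\<close>
        also have "\<dots> = (\<Sum>is | length is = m - 1. Z (i # is) * (\<Prod>j\<leftarrow>is. y j))"
          by (rule sum.mono_neutral_left[OF finite_index_lists])
            (auto simp: prod_list_zero_iff image_iff dest!: y(2)[symmetric])
        also have "\<dots> = l * y i ^ (m - 1)"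
          using True S by (intro maximizer_eigen[OF assms(1,2) y(1,2) eq max]) auto
        also have "\<dots> \<le> s * v i ^ (m - 1)"
          using True \<open>l \<le> s\<close> y(1)[of i] by (auto simp: v_def intro!: mult_right_mono)
        finally show ?thesis .
      next
        case False
        have "(\<Sum>is | length is = m - 1 \<and> set is \<subseteq> T. Z (i # is) * (\<Prod>j\<leftarrow>is. v j))
            = (\<Sum>is | length is = m - 1 \<and> set is \<subseteq> T - S. Z (i # is) * (\<Prod>j\<leftarrow>is. v j))"
        proof (rule sum.mono_neutral_right[OF fin], blast, rule ballI)
          fix "is" assume "is": "is \<in> {is. length is = m - 1 \<and> set is \<subseteq> T}
             - {is. length is = m - 1 \<and> set is \<subseteq> T - S}"
          then obtain k where "k \<in> set is" "k \<in> S" by auto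
          then have "Z (i # is) = 0"
            using False i "is" assms(1) by (intro mixed[of _ k i]) auto
          then show "Z (i # is) * (\<Prod>j\<leftarrow>is. v j) = 0" by simp
        qed
        also have "\<dots> = (\<Sum>is | length is = m - 1 \<and> set is \<subseteq> T - S. Z (i # is) * (\<Prod>j\<leftarrow>is. w j))"
        proof (intro sum.cong refl)
          fix "is" assume "is \<in> {is. length is = m - 1 \<and> set is \<subseteq> T - S}"
          then have "map v is = map w is" by (auto simp: v_def)
          then show "Z (i # is) * (\<Prod>j\<leftarrow>is. v j) = Z (i # is) * (\<Prod>j\<leftarrow>is. w j)" by (simp only:)
        qed
        also have "\<dots> \<le> s * v i ^ (m - 1)"
          using w(2)[of i] False i by (simp add: v_def)
        finally show ?thesis .
      qed
    qed
  qed simp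
qed

section \<open>The arithmetic-geometric mean inequality as a sum of squares\<close>

text \<open>The AM-GM argument rests on ring identities, hence an arbitrary commutative ring; over
  polynomials this is the condition inside \<open>has_SOS_decomposition\<close>.\<close>

definition sum_of_squares :: "'a::comm_ring_1 \<Rightarrow> bool" where
  "sum_of_squares p \<longleftrightarrow> (\<exists>(k::nat) q. p = (\<Sum>r<k. (q r)\<^sup>2))"

section \<open>Closure properties of sums of squares\<close>

lemma sum_of_squares_zero: "sum_of_squares 0"
  unfolding sum_of_squares_def by (rule exI[of _ 0]) simp

lemma sum_of_squares_square: "sum_of_squares (p\<^sup>2)"
  unfolding sum_of_squares_def by (rule exI[of _ 1], rule exI[of _ "\<lambda>_. p"]) simp

lemma sum_of_squares_add:
  assumes "sum_of_squares p" "sum_of_squares q"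
  shows "sum_of_squares (p + q)"
proof -
  obtain k f where p: "p = (\<Sum>r<k::nat. (f r)\<^sup>2)" using assms(1) by (auto simp: sum_of_squares_def)
  obtain n g where q: "q = (\<Sum>r<n::nat. (g r)\<^sup>2)" using assms(2) by (auto simp: sum_of_squares_def)
  define h where "h r = (if r < k then f r else g (r - k))" for r
  have "(\<Sum>r<k + n. (h r)\<^sup>2) = p + q"
    unfolding p q by (induction n) (auto simp: h_def algebra_simps)
  then show ?thesis unfolding sum_of_squares_def by metis
qed

lemma sum_of_squares_sum:
  assumes "\<And>i. i \<in> I \<Longrightarrow> sum_of_squares (f i)"
  shows "sum_of_squares (\<Sum>i\<in>I. f i)"
  using assms by (induction I rule: infinite_finite_induct) (auto intro: sum_of_squares_zero sum_of_squares_add)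

lemma sum_of_squares_sum_list:
  assumes "\<And>i. i \<in> set xs \<Longrightarrow> sum_of_squares (f i)"
  shows "sum_of_squares (\<Sum>i\<leftarrow>xs. f i)"
  using assms by (induction xs) (auto intro: sum_of_squares_zero sum_of_squares_add)

lemma sum_of_squares_square_mult:
  assumes "sum_of_squares p"
  shows "sum_of_squares (c\<^sup>2 * p)"
proof -
  obtain k f where p: "p = (\<Sum>r<k::nat. (f r)\<^sup>2)" using assms by (auto simp: sum_of_squares_def)
  have "c\<^sup>2 * p = (\<Sum>r<k. (c * f r)\<^sup>2)" by (simp add: p sum_distrib_left power_mult_distrib)
  then show ?thesis unfolding sum_of_squares_def by (intro exI)
qed

lemma sum_of_squares_of_nat_mult:
  assumes "sum_of_squares p"
  shows "sum_of_squares (of_nat n * p)"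
  using assms by (induction n) (auto simp: distrib_right intro: sum_of_squares_zero sum_of_squares_add)

text \<open>With \<open>X = x\<^sup>2\<close>, \<open>Y = y\<^sup>2\<close> and \<open>B k\<close>
  the expression, \<open>B (k + 1) = X * B k + (k + 1) * Y ^ k * (X - Y)\<^sup>2\<close>, and
  \<open>Y ^ k * (X - Y)\<^sup>2\<close> is the square of \<open>y ^ k * (X - Y)\<close>.\<close>

lemma sum_of_squares_bernoulli:
  fixes x y :: "'a::comm_ring_1"
  shows "sum_of_squares ((x\<^sup>2) ^ Suc k + of_nat k * (y\<^sup>2) ^ Suc k - of_nat (Suc k) * (x\<^sup>2 * (y\<^sup>2) ^ k))"
proof (induction k)
  case 0
  show ?case by (simp add: sum_of_squares_zero)
next
  case (Suc k)
  have "sum_of_squares (of_nat (Suc k) * ((y ^ k * (x\<^sup>2 - y\<^sup>2))\<^sup>2))"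
    by (intro sum_of_squares_of_nat_mult sum_of_squares_square)
  from sum_of_squares_add[OF sum_of_squares_square_mult[OF Suc.IH, of x] this]
  show ?case
    by (simp add: algebra_simps power2_eq_square power_mult_distrib)
qed

text \<open>
  Induction on the list: bound the product of the tail by the mean of its powers, and then
  each mixed term \<open>x\<^sub>i\<^sup>2 x\<^sub>j\<^sup>2\<^sup>k\<close> by the weighted two-variable inequality.
\<close>

lemma sum_of_squares_amgm_even:
  fixes x :: "'i \<Rightarrow> 'a::comm_ring_1"
  assumes scale: "\<And>n p. sum_of_squares (of_nat (Suc n) * p :: 'a) \<Longrightarrow> sum_of_squares p"
  shows "sum_of_squares ((\<Sum>j\<leftarrow>xs. (x j)\<^sup>2 ^ length xs) - of_nat (length xs) * (\<Prod>j\<leftarrow>xs. x j)\<^sup>2)"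
proof (induction xs)
  case Nil
  show ?case by (simp add: sum_of_squares_zero)
next
  case (Cons i xs)
  show ?case
  proof (cases xs)
    case Nil
    then show ?thesis by (simp add: sum_of_squares_zero)
  next
    case (Cons i' xs')
    define k where "k = length xs"
    obtain k' where k': "k = Suc k'" using Cons by (auto simp: k_def)
    let ?P = "(\<Prod>j\<leftarrow>xs. x j)\<^sup>2" and ?X = "(x i)\<^sup>2" and ?S = "\<lambda>e. \<Sum>j\<leftarrow>xs. (x j)\<^sup>2 ^ e"
    \<comment> \<open>In the sum of \<open>1\<close> and \<open>2\<close> the terms
      \<open>?X * ?S k\<close> cancel and \<open>k\<close> times the goal remains. The hypothesis
      \<open>scale\<close> removes the factor \<open>k\<close>, which must be positive; hence the
      separate case of an empty tail.\<close>
    have 1: "sum_of_squares (of_nat (Suc k) * (?X * (?S k - of_nat k * ?P)))"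
      using Cons.IH by (intro sum_of_squares_of_nat_mult sum_of_squares_square_mult) (simp add: k_def)
    have 2: "sum_of_squares (\<Sum>j\<leftarrow>xs. ?X ^ Suc k + of_nat k * (x j)\<^sup>2 ^ Suc k - of_nat (Suc k) * (?X * (x j)\<^sup>2 ^ k))"
      by (intro sum_of_squares_sum_list sum_of_squares_bernoulli)
    have "(\<Sum>j\<leftarrow>xs. ?X ^ Suc k + of_nat k * (x j)\<^sup>2 ^ Suc k - of_nat (Suc k) * (?X * (x j)\<^sup>2 ^ k))
       = of_nat k * ?X ^ Suc k + of_nat k * ?S (Suc k) - of_nat (Suc k) * (?X * ?S k)"
      by (simp only: sum_list_addf sum_list_subtractf sum_list_const_mult)
         (simp add: k_def sum_list_triv)
    with sum_of_squares_add[OF 1 2]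
    have "sum_of_squares (of_nat (Suc k') * (?X ^ Suc k + ?S (Suc k) - of_nat (Suc k) * (?X * ?P)))"
      by (simp add: algebra_simps flip: k')
    then have "sum_of_squares (?X ^ Suc k + ?S (Suc k) - of_nat (Suc k) * (?X * ?P))"
      by (rule scale)
    then show ?thesis by (simp add: k_def power_mult_distrib)
  qed
qed

text \<open>Splitting the product into two halves \<open>p q\<close> reduces \<open>\<plusminus> 2 p q\<close> to \<open>p\<^sup>2 + q\<^sup>2\<close>.\<close>

lemma sum_of_squares_amgm:
  fixes x :: "'i \<Rightarrow> 'a::comm_ring_1"
  assumes scale: "\<And>n p. sum_of_squares (of_nat (Suc n) * p :: 'a) \<Longrightarrow> sum_of_squares p"
    and "even (length xs)" and e: "e = 1 \<or> e = - 1"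
  shows "sum_of_squares ((\<Sum>j\<leftarrow>xs. x j ^ length xs) + of_nat (length xs) * (e * (\<Prod>j\<leftarrow>xs. x j)))"
proof -
  obtain d where d: "length xs = 2 * d" using assms(2) by auto
  define us vs where "us = take d xs" and "vs = drop d xs"
  have split: "xs = us @ vs" and len: "length us = d" "length vs = d"
    by (auto simp: us_def vs_def d)
  define p q where "p = (\<Prod>j\<leftarrow>us. x j)" and "q = (\<Prod>j\<leftarrow>vs. x j)"
  have u: "sum_of_squares ((\<Sum>j\<leftarrow>us. x j ^ (2 * d)) - of_nat d * p\<^sup>2)"
    using sum_of_squares_amgm_even[of x us, OF scale] by (simp add: len p_def power_mult)
  have v: "sum_of_squares ((\<Sum>j\<leftarrow>vs. x j ^ (2 * d)) - of_nat d * q\<^sup>2)"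
    using sum_of_squares_amgm_even[of x vs, OF scale] by (simp add: len q_def power_mult)
  have w: "sum_of_squares (of_nat d * (p + e * q)\<^sup>2)"
    by (intro sum_of_squares_of_nat_mult sum_of_squares_square)
  have ee: "(p + e * q)\<^sup>2 = p\<^sup>2 + q\<^sup>2 + 2 * (e * (p * q))"
    using e by (auto simp: power2_eq_square algebra_simps)
  have pq: "(\<Prod>j\<leftarrow>xs. x j) = p * q"
    by (simp add: split p_def q_def)
  have S: "(\<Sum>j\<leftarrow>xs. x j ^ (2 * d)) = (\<Sum>j\<leftarrow>us. x j ^ (2 * d)) + (\<Sum>j\<leftarrow>vs. x j ^ (2 * d))"
    by (simp add: split)
  show ?thesis
    using sum_of_squares_add[OF sum_of_squares_add[OF u v] w]
    unfolding d pq S ee by (simp add: algebra_simps)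
qed

section \<open>Constant polynomials\<close>

lemma mpoly_const_0 [simp]: "mpoly_const 0 = 0"
  by (simp add: mpoly_const_def)

lemma mpoly_const_1 [simp]: "mpoly_const 1 = 1"
  by (simp add: mpoly_const_def)

lemma mpoly_const_add: "mpoly_const (a + b) = mpoly_const a + mpoly_const b"
  by (simp add: mpoly_const_def single_add)

lemma mpoly_const_diff: "mpoly_const (a - b) = mpoly_const a - mpoly_const b"
  by (simp add: mpoly_const_def single_diff)

lemma mpoly_const_uminus: "mpoly_const (- a) = - mpoly_const a"
  by (simp add: mpoly_const_def single_uminus)

lemma mpoly_const_mult: "mpoly_const (a * b) = mpoly_const a * mpoly_const b"
  by (simp add: mpoly_const_def mult_single)

lemma mpoly_const_of_nat: "mpoly_const (of_nat n) = of_nat n"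
  by (induction n) (auto simp: mpoly_const_add)

lemma mpoly_const_sum: "mpoly_const (\<Sum>i\<in>I. f i) = (\<Sum>i\<in>I. mpoly_const (f i))"
  by (induction I rule: infinite_finite_induct) (auto simp: mpoly_const_add)

lemma mpoly_const_power: "mpoly_const (a ^ n) = mpoly_const a ^ n"
  by (induction n) (auto simp: mpoly_const_mult)

lemma mpoly_const_prod_list: "mpoly_const (\<Prod>i\<leftarrow>is. f i) = (\<Prod>i\<leftarrow>is. mpoly_const (f i))"
  by (induction "is") (auto simp: mpoly_const_mult)

lemma sum_of_squares_const_mult:
  assumes "0 \<le> c" "sum_of_squares p"
  shows "sum_of_squares (mpoly_const c * p)"
proof -
  have "mpoly_const c = (mpoly_const (sqrt c))\<^sup>2" using assms(1) by (simp flip: mpoly_const_power)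
  then show ?thesis using assms(2) by (metis sum_of_squares_square_mult)
qed

text \<open>The constant \<open>1 / Suc n\<close> is the square of a real constant. This provides
  the hypothesis \<open>scale\<close> of the AM-GM lemmas for real polynomials.\<close>

lemma sum_of_squares_cancel_of_nat:
  fixes p :: "'n real_mpoly"
  assumes "sum_of_squares (of_nat (Suc n) * p)"
  shows "sum_of_squares p"
proof -
  have "mpoly_const (1 / real (Suc n)) * (of_nat (Suc n) * p) = mpoly_const (1 / real (Suc n) * real (Suc n)) * p"
    by (simp only: mpoly_const_mult mpoly_const_of_nat mult.assoc)
  also have "\<dots> = p" by simp
  finally show ?thesis
    using sum_of_squares_const_mult[OF _ assms, of "1 / real (Suc n)"] by simp
qed

section \<open>Symmetric H-tensors\<close>

lemma diagonal_index_iff: "length is = m \<Longrightarrow> diagonal_index is \<longleftrightarrow> (\<exists>i. is = replicate m i)"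
  by (auto simp: diagonal_index_def)

lemma diagonal_index_mset_cong:
  assumes "mset is = mset js"
  shows "diagonal_index is \<longleftrightarrow> diagonal_index js"
proof -
  \<comment> \<open>Being diagonal depends only on the set of indices, which the multiset
    determines.\<close>
  have "diagonal_index is \<longleftrightarrow> (\<exists>i. set is \<subseteq> {i})" for "is" :: "'a list"
  proof
    show "\<exists>i. set is \<subseteq> {i}" if "diagonal_index is"
      using that unfolding diagonal_index_def by (metis set_replicate_conv_if empty_subsetI order_refl)
    show "diagonal_index is" if "\<exists>i. set is \<subseteq> {i}"
      using that unfolding diagonal_index_def by (metis replicate_length_same singletonD subsetD)
  qed
  then show ?thesis using mset_eq_setD[OF assms] by simp
qed

text \<open>Each off-diagonal entry is matched with the AM-GM expression of its index list, weighted
  by its modulus. By symmetry the powers of \<open>u i\<close> used up in this way amount to the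
  off-diagonal row sum, which dominance lets the diagonal entry cover.\<close>

lemma sum_of_squares_diagonally_dominant:
  fixes a :: "('n::finite) tensor" and u :: "'n \<Rightarrow> 'n real_mpoly"
  assumes "even m" "0 < m" and sym: "symmetric_tensor m a"
    and dom: "\<And>i. (\<Sum>is | length is = m - 1. if diagonal_index (i # is) then 0 else \<bar>a (i # is)\<bar>) \<le> a (replicate m i)"
  shows "sum_of_squares (\<Sum>is | length is = m. mpoly_const (a is) * (\<Prod>j\<leftarrow>is. u j))"
proof -
  obtain n where n: "m = Suc n" using assms(2) by (cases m) auto
  \<comment> \<open>\<open>b\<close> and \<open>e\<close> are modulus and sign of the off-diagonal
    entries, \<open>c\<close> is the slack in row dominance, and \<open>G\<close> is the AM-GM
    expression of the signed product.\<close>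
  define b where "b is = (if diagonal_index is then 0 else \<bar>a is\<bar>)" for "is"
  define e where "e is = (if a is < 0 then - 1 else 1 :: 'n real_mpoly)" for "is"
  define c where "c i = a (replicate m i) - (\<Sum>is | length is = n. b (i # is))" for i
  define G where "G is = (\<Sum>j\<leftarrow>is. u j ^ m) + of_nat m * (e is * (\<Prod>j\<leftarrow>is. u j))" for "is"
  have c: "0 \<le> c i" for i using dom[of i] by (simp add: c_def b_def n)
  have G: "sum_of_squares (G is)" if "length is = m" for "is"
    using sum_of_squares_amgm[of "is" "e is" u, OF sum_of_squares_cancel_of_nat] that assms(1)
    by (simp add: G_def e_def)
  have b_sym: "b is = b js" if "length is = m" "mset is = mset js" for "is" js
  proof -
    have "a is = a js" using that sym unfolding symmetric_tensor_def by blast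
    then show ?thesis by (simp only: b_def diagonal_index_mset_cong[OF that(2)])
  qed
  have marked: "(\<Sum>is | length is = m. mpoly_const (b is) * (\<Sum>j\<leftarrow>is. u j ^ m))
      = of_nat m * (\<Sum>j\<in>UNIV. u j ^ m * mpoly_const (\<Sum>is | length is = n. b (j # is)))"
    unfolding n mpoly_const_sum by (rule sum_lists_marked) (simp add: b_sym n)
  have diag: "(\<Sum>is | length is = m \<and> diagonal_index is. mpoly_const (a is) * (\<Prod>j\<leftarrow>is. u j))
      = (\<Sum>i\<in>UNIV. mpoly_const (a (replicate m i)) * u i ^ m)"
  proof -
    have eq: "{is. length is = m \<and> diagonal_index is} = range (replicate m)"
      by (auto simp: diagonal_index_iff)
    show ?thesis
      unfolding eq using assms(2) by (subst sum.reindex) (auto simp: inj_on_def map_replicate_const prod_list_replicate)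
  qed
  have off: "of_nat m * (\<Sum>is | length is = m \<and> \<not> diagonal_index is. mpoly_const (a is) * (\<Prod>j\<leftarrow>is. u j))
      = (\<Sum>is | length is = m. of_nat m * (mpoly_const (b is) * (e is * (\<Prod>j\<leftarrow>is. u j))))"
  proof -
    have ae: "mpoly_const (a is) = mpoly_const (b is) * e is" if "\<not> diagonal_index is" for "is"
      using that by (auto simp: b_def e_def mpoly_const_uminus)
    have "(\<Sum>is | length is = m \<and> \<not> diagonal_index is. mpoly_const (a is) * (\<Prod>j\<leftarrow>is. u j))
        = (\<Sum>is | length is = m. mpoly_const (b is) * (e is * (\<Prod>j\<leftarrow>is. u j)))"
      by (intro sum.mono_neutral_cong_left finite_index_lists)
        (auto simp: ae b_def mult.assoc)
    then show ?thesis by (simp add: sum_distrib_left)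
  qed
  have "(\<Sum>is | length is = m. mpoly_const (a is) * (\<Prod>j\<leftarrow>is. u j))
      = (\<Sum>i\<in>UNIV. mpoly_const (a (replicate m i)) * u i ^ m)
        + (\<Sum>is | length is = m \<and> \<not> diagonal_index is. mpoly_const (a is) * (\<Prod>j\<leftarrow>is. u j))"
    unfolding diag[symmetric]
    by (subst sum.union_disjoint[symmetric])
      (auto intro!: sum.cong finite_subset[OF _ finite_index_lists[of m]])
  \<comment> \<open>Working with \<open>m\<close> times the form avoids fractions; the factor is
    cancelled at the end.\<close>
  then have "of_nat m * (\<Sum>is | length is = m. mpoly_const (a is) * (\<Prod>j\<leftarrow>is. u j))
      = of_nat m * (\<Sum>i\<in>UNIV. mpoly_const (a (replicate m i)) * u i ^ m)
        + (\<Sum>is | length is = m. of_nat m * (mpoly_const (b is) * (e is * (\<Prod>j\<leftarrow>is. u j))))"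
    by (simp only: distrib_left off)
  also have "(\<Sum>is | length is = m. of_nat m * (mpoly_const (b is) * (e is * (\<Prod>j\<leftarrow>is. u j))))
      = (\<Sum>is | length is = m. mpoly_const (b is) * G is)
        - (\<Sum>is | length is = m. mpoly_const (b is) * (\<Sum>j\<leftarrow>is. u j ^ m))"
    unfolding sum_subtractf[symmetric] by (intro sum.cong) (auto simp: G_def algebra_simps)
  also have "of_nat m * (\<Sum>i\<in>UNIV. mpoly_const (a (replicate m i)) * u i ^ m) + \<dots>
      = of_nat m * (\<Sum>i\<in>UNIV. mpoly_const (c i) * u i ^ m)
        + (\<Sum>is | length is = m. mpoly_const (b is) * G is)"
    unfolding marked
    by (simp add: c_def mpoly_const_diff left_diff_distrib right_diff_distrib sum_subtractf mult.commute)
  finally have *: "of_nat m * (\<Sum>is | length is = m. mpoly_const (a is) * (\<Prod>j\<leftarrow>is. u j))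
      = of_nat m * (\<Sum>i\<in>UNIV. mpoly_const (c i) * u i ^ m)
        + (\<Sum>is | length is = m. mpoly_const (b is) * G is)" .
  have "sum_of_squares (u i ^ m)" for i
    using assms(1) sum_of_squares_square[of "u i ^ (m div 2)"] by (simp flip: power_mult)
  then have "sum_of_squares (of_nat m * (\<Sum>i\<in>UNIV. mpoly_const (c i) * u i ^ m)
        + (\<Sum>is | length is = m. mpoly_const (b is) * G is))"
    using c G by (intro sum_of_squares_add sum_of_squares_of_nat_mult sum_of_squares_sum
        sum_of_squares_const_mult) (auto simp: b_def)
  then show ?thesis
    unfolding *[symmetric] unfolding n by (rule sum_of_squares_cancel_of_nat)
qed

section \<open>Diagonal scaling and reduction to diagonal dominance\<close>

theorem theorem3p7:
  fixes A :: "('n::finite) tensor" and m :: nat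
  assumes "even m" and "m > 0"
    and "symmetric_tensor m A"
    and "H_tensor m A"
    and "\<And>i. A (replicate m i) \<ge> 0"
  shows "has_SOS_decomposition m A"
proof -
  have "1 < m" using assms(1,2) by (cases "m = 1") auto
  obtain Z s where Z: "nonneg_tensor m Z" and s: "tensor_spectral_radius m Z \<le> s"
    and M: "\<And>is. length is = m \<Longrightarrow> comparison_tensor A is = s * identity_tensor is - Z is"
    using assms(4) by (auto simp: H_tensor_def)
  have Z_off: "Z is = \<bar>A is\<bar>" if "length is = m" "\<not> diagonal_index is" for "is"
    using M[OF that(1)] that(2) by (simp add: comparison_tensor_def identity_tensor_def)
  have Z_diag: "A (replicate m i) = s - Z (replicate m i)" for i
  proof -
    have "diagonal_index (replicate m i)" by (auto simp: diagonal_index_def)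
    then show ?thesis
      using M[of "replicate m i"] assms(5)[of i] by (simp add: comparison_tensor_def identity_tensor_def)
  qed
  \<comment> \<open>By \<open>M\<close> an entry of \<open>Z\<close> depends only on
    \<open>s\<close>, the entry of \<open>A\<close> and whether the index is diagonal, all invariant
    under permutation.\<close>
  have "symmetric_tensor m Z"
    unfolding symmetric_tensor_def
  proof (intro allI impI)
    fix "is" js :: "'n list"
    assume eq: "length is = m" "mset is = mset js"
    then have "A is = A js" using assms(3) unfolding symmetric_tensor_def by blast
    moreover have "length js = m" using eq mset_eq_length by metis
    ultimately show "Z is = Z js"
      using M[of "is"] M[of js] eq(1) diagonal_index_mset_cong[OF eq(2)]
      by (simp add: comparison_tensor_def identity_tensor_def split: if_splits)
  qed
  have "form_value m Z z \<le> s * (\<Sum>i\<in>UNIV. z i ^ m)" if "\<And>i. 0 \<le> z i" for z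
  proof -
    have "form_value m Z z \<le> tensor_spectral_radius m Z * (\<Sum>i\<in>UNIV. z i ^ m)"
      using \<open>1 < m\<close> \<open>symmetric_tensor m Z\<close> Z that by (rule form_value_le_spectral_radius)
    also have "\<dots> \<le> s * (\<Sum>i\<in>UNIV. z i ^ m)"
      by (intro mult_right_mono s sum_nonneg zero_le_power that)
    finally show ?thesis .
  qed
  then have "\<exists>y. (\<forall>i\<in>UNIV. 0 < y i) \<and> (\<forall>i\<in>UNIV. (\<Sum>is | length is = m - 1 \<and> set is \<subseteq> UNIV.
      Z (i # is) * (\<Prod>j\<leftarrow>is. y j)) \<le> s * y i ^ (m - 1))"
    by (intro positive_subeigenvector[OF assms(2) \<open>symmetric_tensor m Z\<close> Z]) blast
  then obtain y where y': "\<forall>i\<in>UNIV. 0 < y i"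
    and sub': "\<forall>i\<in>UNIV. (\<Sum>is | length is = m - 1 \<and> set is \<subseteq> UNIV.
      Z (i # is) * (\<Prod>j\<leftarrow>is. y j)) \<le> s * y i ^ (m - 1)"
    by (elim exE conjE) (rule that)
  have y: "0 < y i" for i using y' by simp
  have sub: "(\<Sum>is | length is = m - 1. Z (i # is) * (\<Prod>j\<leftarrow>is. y j)) \<le> s * y i ^ (m - 1)" for i
    using bspec[OF sub' UNIV_I, of i] by simp
  \<comment> \<open>\<open>a\<close> absorbs the factors \<open>y\<close>, and \<open>u j\<close> is
    the variable divided by \<open>y j\<close>, so the form of \<open>a\<close> at \<open>u\<close>
    is the form of \<open>A\<close> in the original variables.\<close>
  define a where "a is = A is * (\<Prod>j\<leftarrow>is. y j)" for "is"
  define u where "u j = mpoly_const (inverse (y j)) * mpoly_var j" for j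
  have "symmetric_tensor m a"
    unfolding symmetric_tensor_def
  proof (intro allI impI)
    fix "is" js :: "'n list"
    assume eq: "length is = m" "mset is = mset js"
    then have "A is = A js" using assms(3) unfolding symmetric_tensor_def by blast
    then show "a is = a js" by (simp only: a_def prod_list_map_mset_cong[OF eq(2), of y])
  qed
  moreover have "(\<Sum>is | length is = m - 1. if diagonal_index (i # is) then 0 else \<bar>a (i # is)\<bar>)
      \<le> a (replicate m i)" for i
  proof -
    define d where "d = replicate (m - 1) i"
    have d: "i # d = replicate m i" "length d = m - 1"
      using assms(2) by (auto simp: d_def simp flip: replicate_Suc)
    have diag: "diagonal_index (i # is) \<longleftrightarrow> is = d" if "length is = m - 1" for "is"
      using that assms(2) d by (subst diagonal_index_iff[of _ m]) (auto simp: d_def Cons_replicate_eq)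
    have y_nn: "0 \<le> (\<Prod>j\<leftarrow>is. y j)" for "is" by (intro prod_list_map_nonneg less_imp_le y)
    have y_d: "(\<Prod>j\<leftarrow>d. y j) = y i ^ (m - 1)"
      by (simp add: d_def map_replicate_const prod_list_replicate)
    \<comment> \<open>The row sum of \<open>a\<close> is \<open>y i\<close> times the row of
      \<open>Z\<close> at \<open>y\<close> without its diagonal term. Bounding the full row by
      \<open>sub\<close> leaves the coefficient \<open>s - Z (i # d)\<close>, which is the diagonal
      entry of \<open>A\<close>.\<close>
    have "(\<Sum>is | length is = m - 1. if diagonal_index (i # is) then 0 else \<bar>a (i # is)\<bar>)
        = (\<Sum>is\<in>{is. length is = m - 1} - {d}. y i * (Z (i # is) * (\<Prod>j\<leftarrow>is. y j)))"
      using assms(2) y y_nn less_imp_le[OF y]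
      by (intro sum.mono_neutral_cong_right finite_index_lists)
        (auto simp: diag a_def Z_off abs_mult)
    also have "\<dots> = y i * ((\<Sum>is | length is = m - 1. Z (i # is) * (\<Prod>j\<leftarrow>is. y j)) - Z (i # d) * y i ^ (m - 1))"
      by (subst (2) sum.remove[of _ d]) (auto simp: finite_index_lists d y_d sum_distrib_left)
    also have "\<dots> \<le> y i * (s * y i ^ (m - 1) - Z (i # d) * y i ^ (m - 1))"
      using sub[of i] y[of i] by simp
    also have "\<dots> = A (i # d) * (\<Prod>j\<leftarrow>i # d. y j)"
    proof -
      have "A (i # d) = s - Z (i # d)" by (simp only: d Z_diag)
      moreover have "(\<Prod>j\<leftarrow>i # d. y j) = y i * y i ^ (m - 1)" by (simp add: y_d)
      ultimately show ?thesis by (simp only:) (simp only: algebra_simps)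
    qed
    finally show ?thesis unfolding d(1)[symmetric] a_def .
  qed
  ultimately have "sum_of_squares (\<Sum>is | length is = m. mpoly_const (a is) * (\<Prod>j\<leftarrow>is. u j))"
    by (rule sum_of_squares_diagonally_dominant[OF assms(1,2)])
  also have "(\<Sum>is | length is = m. mpoly_const (a is) * (\<Prod>j\<leftarrow>is. u j)) = tensor_form m A"
    unfolding tensor_form_def
  proof (intro sum.cong refl)
    fix "is" :: "'n list"
    have "mpoly_const (y j) * u j = mpoly_var j" for j
    proof -
      have "mpoly_const (y j) * u j = mpoly_const (y j * inverse (y j)) * mpoly_var j"
        by (simp only: u_def mpoly_const_mult mult.assoc)
      then show ?thesis using y[of j] by simp
    qed
    then have "(\<Prod>j\<leftarrow>is. mpoly_var j) = (\<Prod>j\<leftarrow>is. mpoly_const (y j) * u j)"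
      by (simp only:)
    also have "\<dots> = mpoly_const (\<Prod>j\<leftarrow>is. y j) * (\<Prod>j\<leftarrow>is. u j)"
      unfolding mpoly_const_prod_list by (induction "is") (auto simp: algebra_simps)
    finally show "mpoly_const (a is) * (\<Prod>j\<leftarrow>is. u j) = mpoly_const (A is) * (\<Prod>j\<leftarrow>is. mpoly_var j)"
      by (simp only: a_def mpoly_const_mult mult.assoc)
  qed
  finally show ?thesis
    unfolding has_SOS_decomposition_def sum_of_squares_def .
qed

end
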